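(* Let $\mathbf c\in\mathbb Z_{\ge0}^n$ and let $M$ be a proper $\mathbf c$-multicomplex. Identifying $x_{i,j}$ with $x_i^{(j)}$, the Stanley–Reisner ideal of $\mathrm{Bier}_{\mathbf c}(M)$ in $\widetilde S$ is $$I_{\mathrm{Bier}_{\mathbf c}(M)}=\mathrm{pol}(I_{\mathbf c}(M))+\mathrm{pol}^*(I_{\mathbf c}(M^\vee))+\mathrm{pol}\big((x_1^{c_1+1},\dots,x_n^{c_n+1})\big).$$
   Context: Let $K$ be a field, $\mathbf c=(c_1,\dots,c_n)\in\mathbb Z_{\ge0}^n$, $\overline{\mathbf c}=(c_1+1,\dots,c_n+1)$, $S=K[x_1,\dots,x_n]$, $x^{\mathbf a}=x_1^{a_1}\cdots x_n^{a_n}$. A $\mathbf c$-monomial is $x^{\mathbf a}$ with $a_i\le c_i$ for all $i$. A $\mathbf c$-multicomplex is a nonempty set $M$ of $\mathbf c$-monomials closed under taking divisors, proper if it is not the set of all $\mathbf c$-monomials. $M^\vee=\{x_1^{c_1-a_1}\cdots x_n^{c_n-a_n}:x^{\mathbf a}\text{ a }\mathbf c\text{-monomial},\ x^{\mathbf a}\notin M\}$ (Alexander dual w.r.t. $\mathbf c$). For a $\mathbf c$-multicomplex $N$, $I_{\mathbf c}(N)\subset S$ is the ideal generated by all $\mathbf c$-monomials not in $N$. Let $\widetilde X=\{x_i^{(j)}:1\le i\le n,0\le j\le c_i\}$, $F_{\mathbf c}(x^{\mathbf a})=\widetilde X\setminus\{x_1^{(a_1)},\dots,x_n^{(a_n)}\}$,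 $\mathcal B_{\mathbf c}(M)$ the simplicial complex of all subsets of the sets $F_{\mathbf c}(x^{\mathbf a})$, $x^{\mathbf a}\in M$; for a pure $(d-1)$-dimensional complex $B$, $\partial B$ is generated by the $(d-1)$-element faces lying in exactly one facet, and $\mathrm{Bier}_{\mathbf c}(M)=\partial\mathcal B_{\mathbf c}(M)$. Let $\widetilde S=K[x_{i,j}:1\le i\le n,0\le j\le c_i]$. For a $\overline{\mathbf c}$-monomial $x^{\mathbf a}$: $\mathrm{pol}(x^{\mathbf a})=\prod_{a_i\ne0}x_{i,0}\cdots x_{i,a_i-1}$ and $\mathrm{pol}^*(x^{\mathbf a})=\prod_{a_i\ne0}x_{i,c_i}x_{i,c_i-1}\cdots x_{i,c_i-a_i+1}$; for an ideal $I\subset S$ whose minimal monomial generating set $G(I)$ consists of $\overline{\mathbf c}$-monomials, $\mathrm{pol}(I)=(\mathrm{pol}(u):u\in G(I))$ and $\mathrm{pol}^*(I)=(\mathrm{pol}^*(u):u\in G(I))$. The Stanley–Reisner ideal of a complex $\Delta$ on $V$ is generated by $\prod_{v\in F}v$, $F\subset V$, $F\notin\Delta$. *)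

theory Defs
  imports "HOL-Library.Poly_Mapping" "HOL-Algebra.Ideal"
begin

text \<open>
  A monomial in variables of type \<open>'v\<close> is encoded by its exponent vector \<open>'v \<Rightarrow>\<^sub>0 nat\<close>; a polynomial
  is a finitely supported function from monomials to coefficients, with the convolution product.
\<close>

abbreviation lookup :: "('a \<Rightarrow>\<^sub>0 'b::zero) \<Rightarrow> 'a \<Rightarrow> 'b" where
  "lookup \<equiv> Poly_Mapping.lookup"

abbreviation keys :: "('a \<Rightarrow>\<^sub>0 'b::zero) \<Rightarrow> 'a set" where
  "keys \<equiv> Poly_Mapping.keys"

type_synonym 'v mon = "'v \<Rightarrow>\<^sub>0 nat"
type_synonym ('v, 'k) mpoly = "'v mon \<Rightarrow>\<^sub>0 'k"

definition monomial :: "'v mon \<Rightarrow> ('v, 'k::field) mpoly" where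
  "monomial a = Poly_Mapping.single a 1"

definition var :: "'v \<Rightarrow> ('v, 'k::field) mpoly" where
  "var v = monomial (Poly_Mapping.single v 1)"

definition mdvd :: "'v mon \<Rightarrow> 'v mon \<Rightarrow> bool" where
  "mdvd b a \<longleftrightarrow> (\<forall>v. lookup b v \<le> lookup a v)"

definition mpoly_ring :: "'v set \<Rightarrow> ('v, 'k::field) mpoly ring" where
  "mpoly_ring V =
     \<lparr>carrier = {p. \<forall>m\<in>keys p. keys m \<subseteq> V}, mult = (*), one = 1, zero = 0, add = (+)\<rparr>"

definition is_min_mon_gens :: "'v set \<Rightarrow> ('v, 'k::field) mpoly set \<Rightarrow> 'v mon set \<Rightarrow> bool" where
  "is_min_mon_gens V I G \<longleftrightarrow>
     (\<forall>a\<in>G. keys a \<subseteq> V) \<and> Idl\<^bsub>mpoly_ring V\<^esub> (monomial ` G) = I \<and>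
     (\<forall>H. H \<subset> G \<longrightarrow> Idl\<^bsub>mpoly_ring V\<^esub> (monomial ` H) \<noteq> I)"

text \<open>Existence and uniqueness for monomial ideals is the lemma \<open>min_mon_gens_Idl\<close> below.\<close>

definition min_mon_gens :: "'v set \<Rightarrow> ('v, 'k::field) mpoly set \<Rightarrow> 'v mon set" where
  "min_mon_gens V I = (THE G. is_min_mon_gens V I G)"


subsection \<open>Multicomplexes\<close>

text \<open>
  The vector \<open>\<^bold>c\<close> is a function of which only the values at \<open>1, \<dots>, n\<close> matter.
\<close>

definition c_monomials :: "nat \<Rightarrow> (nat \<Rightarrow> nat) \<Rightarrow> nat mon set" where
  "c_monomials n c = {a. keys a \<subseteq> {1..n} \<and> (\<forall>i\<in>{1..n}. lookup a i \<le> c i)}"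

definition multicomplex :: "nat \<Rightarrow> (nat \<Rightarrow> nat) \<Rightarrow> nat mon set \<Rightarrow> bool" where
  "multicomplex n c M \<longleftrightarrow>
     M \<noteq> {} \<and> M \<subseteq> c_monomials n c \<and> (\<forall>a\<in>M. \<forall>b. mdvd b a \<longrightarrow> b \<in> M)"

definition proper_multicomplex :: "nat \<Rightarrow> (nat \<Rightarrow> nat) \<Rightarrow> nat mon set \<Rightarrow> bool" where
  "proper_multicomplex n c M \<longleftrightarrow> multicomplex n c M \<and> M \<noteq> c_monomials n c"

definition alexander_dual :: "nat \<Rightarrow> (nat \<Rightarrow> nat) \<Rightarrow> nat mon set \<Rightarrow> nat mon set" where
  "alexander_dual n c M =
     {(\<Sum>i=1..n. Poly_Mapping.single i (c i - lookup a i)) | a. a \<in> c_monomials n c \<and> a \<notin> M}"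

definition mc_ideal :: "nat \<Rightarrow> (nat \<Rightarrow> nat) \<Rightarrow> nat mon set \<Rightarrow> (nat, 'k::field) mpoly set" where
  "mc_ideal n c N = Idl\<^bsub>mpoly_ring {1..n}\<^esub> (monomial ` (c_monomials n c - N))"


subsection \<open>Simplicial complexes and Bier spheres\<close>

text \<open>A simplicial complex is its set of faces.\<close>

definition facets :: "'v set set \<Rightarrow> 'v set set" where
  "facets B = {F \<in> B. \<forall>G\<in>B. F \<subseteq> G \<longrightarrow> G = F}"

text \<open>For a pure \<open>(d - 1)\<close>-dimensional complex, \<open>Max (card ` B)\<close> is \<open>d\<close>.\<close>

definition boundary :: "'v set set \<Rightarrow> 'v set set" where
  "boundary B = {F. \<exists>G\<in>B. card G + 1 = Max (card ` B) \<and> (\<exists>!H. H \<in> facets B \<and> G \<subseteq> H) \<and> F \<subseteq> G}"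

text \<open>The pair \<open>(i, j)\<close> is both the vertex \<open>x\<^sub>i\<^bsup>(j)\<^esup>\<close> and the index of the variable \<open>x\<^bsub>i,j\<^esub>\<close>.\<close>

definition Xtilde :: "nat \<Rightarrow> (nat \<Rightarrow> nat) \<Rightarrow> (nat \<times> nat) set" where
  "Xtilde n c = {(i, j). 1 \<le> i \<and> i \<le> n \<and> j \<le> c i}"

definition c_facet :: "nat \<Rightarrow> (nat \<Rightarrow> nat) \<Rightarrow> nat mon \<Rightarrow> (nat \<times> nat) set" where
  "c_facet n c a = Xtilde n c - {(i, lookup a i) | i. i \<in> {1..n}}"

definition c_ball :: "nat \<Rightarrow> (nat \<Rightarrow> nat) \<Rightarrow> nat mon set \<Rightarrow> (nat \<times> nat) set set" where
  "c_ball n c M = {F. \<exists>a\<in>M. F \<subseteq> c_facet n c a}"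

definition bier :: "nat \<Rightarrow> (nat \<Rightarrow> nat) \<Rightarrow> nat mon set \<Rightarrow> (nat \<times> nat) set set" where
  "bier n c M = boundary (c_ball n c M)"

definition stanley_reisner_ideal :: "'v set \<Rightarrow> 'v set set \<Rightarrow> ('v, 'k::field) mpoly set" where
  "stanley_reisner_ideal V \<Delta> = Idl\<^bsub>mpoly_ring V\<^esub> ((\<lambda>F. \<Prod>v\<in>F. var v) ` {F. F \<subseteq> V \<and> F \<notin> \<Delta>})"


subsection \<open>Polarization\<close>

definition pol_mon :: "nat mon \<Rightarrow> (nat \<times> nat, 'k::field) mpoly" where
  "pol_mon a = (\<Prod>i\<in>keys a. \<Prod>j<lookup a i. var (i, j))"

text \<open>
  The lower bound is \<open>c\<^sub>i + 1 - a\<^sub>i\<close> rather than \<open>c\<^sub>i - a\<^sub>i + 1\<close>, as the latter is wrong with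
  truncated subtraction when \<open>a\<^sub>i = c\<^sub>i + 1\<close>.
\<close>

definition pol_star_mon :: "(nat \<Rightarrow> nat) \<Rightarrow> nat mon \<Rightarrow> (nat \<times> nat, 'k::field) mpoly" where
  "pol_star_mon c a = (\<Prod>i\<in>keys a. \<Prod>j=c i + 1 - lookup a i..c i. var (i, j))"

definition pol_ideal ::
  "nat \<Rightarrow> (nat \<Rightarrow> nat) \<Rightarrow> (nat, 'k::field) mpoly set \<Rightarrow> (nat \<times> nat, 'k) mpoly set" where
  "pol_ideal n c I = Idl\<^bsub>mpoly_ring (Xtilde n c)\<^esub> (pol_mon ` min_mon_gens {1..n} I)"

definition pol_star_ideal ::
  "nat \<Rightarrow> (nat \<Rightarrow> nat) \<Rightarrow> (nat, 'k::field) mpoly set \<Rightarrow> (nat \<times> nat, 'k) mpoly set" where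
  "pol_star_ideal n c I = Idl\<^bsub>mpoly_ring (Xtilde n c)\<^esub> (pol_star_mon c ` min_mon_gens {1..n} I)"


subsection \<open>Well-definedness of the minimal monomial generating set\<close>

lemma mpoly_ring_simps [simp]:
  "p \<in> carrier (mpoly_ring V) \<longleftrightarrow> (\<forall>m\<in>keys p. keys m \<subseteq> V)"
  "mult (mpoly_ring V) = (*)" "one (mpoly_ring V) = 1"
  "zero (mpoly_ring V) = 0" "add (mpoly_ring V) = (+)"
  by (simp_all add: mpoly_ring_def)

lemma keys_add_mon: "keys (a + b :: 'v mon) = keys a \<union> keys b"
  by (auto simp: in_keys_iff lookup_add)

lemma keys_mpoly_multE:
  assumes "m \<in> keys (p * q :: ('v, 'k::field) mpoly)"
  obtains a b where "a \<in> keys p" "b \<in> keys q" "m = a + b"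
  using assms keys_mult[of p q] by blast

lemma keys_mpoly_addE:
  assumes "m \<in> keys (p + q :: ('v, 'k::field) mpoly)"
  obtains "m \<in> keys p" | "m \<in> keys q"
  using assms Poly_Mapping.keys_add[of p q] by blast

lemma keys_mpoly_uminus: "keys (- p :: ('v, 'k::field) mpoly) = keys p"
  by (auto simp: in_keys_iff)

lemma cring_mpoly_ring: "cring (mpoly_ring V :: ('v, 'k::field) mpoly ring)"
proof (rule cringI)
  show "abelian_group (mpoly_ring V :: ('v, 'k) mpoly ring)"
  proof (rule abelian_groupI)
    fix p :: "('v, 'k) mpoly"
    assume "p \<in> carrier (mpoly_ring V)"
    then show "\<exists>q\<in>carrier (mpoly_ring V). q \<oplus>\<^bsub>mpoly_ring V\<^esub> p = \<zero>\<^bsub>mpoly_ring V\<^esub>"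
      by (intro bexI[of _ "- p"]) (auto simp: keys_mpoly_uminus)
  qed (auto simp: algebra_simps elim!: keys_mpoly_addE)
  show "Group.comm_monoid (mpoly_ring V :: ('v, 'k) mpoly ring)"
  proof (rule comm_monoidI)
    fix p q :: "('v, 'k) mpoly"
    assume pq: "p \<in> carrier (mpoly_ring V)" "q \<in> carrier (mpoly_ring V)"
    have "keys m \<subseteq> V" if "m \<in> keys (p * q)" for m
      using that
    proof (rule keys_mpoly_multE)
      fix a b assume "a \<in> keys p" "b \<in> keys q" "m = a + b"
      with pq show ?thesis by (simp add: keys_add_mon)
    qed
    then show "p \<otimes>\<^bsub>mpoly_ring V\<^esub> q \<in> carrier (mpoly_ring V)" by simp
  qed (simp_all add: algebra_simps)
qed (auto simp: algebra_simps)

lemma mdvd_refl: "mdvd a a"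
  and mdvd_trans: "mdvd a b \<Longrightarrow> mdvd b c \<Longrightarrow> mdvd a c"
  by (auto simp: mdvd_def intro: order_trans)

lemma mdvd_antisym: "mdvd a b \<Longrightarrow> mdvd b a \<Longrightarrow> a = b"
  by (intro poly_mapping_eqI order_antisym) (simp_all add: mdvd_def)

lemma mdvd_add: "mdvd a b \<Longrightarrow> mdvd a (b + c)"
  by (auto simp: mdvd_def lookup_add intro: trans_le_add1)

lemma keys_monomial [simp]: "keys (monomial a :: ('v, 'k::field) mpoly) = {a}"
  by (simp add: monomial_def)

lemma monomial_add: "monomial (a + b) = (monomial a * monomial b :: ('v, 'k::field) mpoly)"
  by (simp add: monomial_def mult_single)

lemma mono_in_Idl_iff:
  assumes "\<forall>b\<in>A. keys b \<subseteq> V" and "keys a \<subseteq> V"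
  shows "(monomial a :: ('v, 'k::field) mpoly) \<in> Idl\<^bsub>mpoly_ring V\<^esub> (monomial ` A) \<longleftrightarrow> (\<exists>b\<in>A. mdvd b a)"
proof -
  let ?R = "mpoly_ring V :: ('v, 'k) mpoly ring"
  interpret R: cring ?R by (rule cring_mpoly_ring)
  have sub: "(monomial ` A :: ('v, 'k) mpoly set) \<subseteq> carrier ?R"
    using assms(1) by auto
  define J where "J = {p \<in> carrier ?R. \<forall>m\<in>keys p. \<exists>b\<in>A. mdvd b m}"
  have mi: "a_inv ?R p = - p" if "p \<in> carrier ?R" for p
    using that by (intro R.minus_equality) (auto simp: keys_mpoly_uminus)
  have "ideal J ?R"
  proof (rule idealI)
    show "ring ?R" by (rule R.ring_axioms)
    show "subgroup J (add_monoid ?R)"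
    proof (rule subgroup.intro)
      fix p assume "p \<in> J"
      then show "inv\<^bsub>add_monoid ?R\<^esub> p \<in> J"
        using mi[of p] by (auto simp: J_def a_inv_def keys_mpoly_uminus)
    qed (auto simp: J_def elim!: keys_mpoly_addE)
    have closed: "p * x \<in> J" if p: "p \<in> J" and x: "x \<in> carrier ?R" for p x
    proof -
      have "keys m \<subseteq> V \<and> (\<exists>b\<in>A. mdvd b m)" if "m \<in> keys (p * x)" for m
        using that
      proof (rule keys_mpoly_multE)
        fix a b assume ab: "a \<in> keys p" "b \<in> keys x" "m = a + b"
        obtain d where "d \<in> A" "mdvd d a" using p ab(1) by (auto simp: J_def)
        then have "\<exists>b\<in>A. mdvd b m" using ab(3) mdvd_add by blast
        moreover have "keys a \<subseteq> V" using p ab(1) by (simp add: J_def)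
        moreover have "keys b \<subseteq> V" using x ab(2) by simp
        ultimately show ?thesis using ab(3) by (simp add: keys_add_mon)
      qed
      then show ?thesis by (simp add: J_def)
    qed
    show "x \<otimes>\<^bsub>?R\<^esub> p \<in> J" if "p \<in> J" "x \<in> carrier ?R" for p x
      using closed[OF that] by (simp add: mult.commute)
    show "p \<otimes>\<^bsub>?R\<^esub> x \<in> J" if "p \<in> J" "x \<in> carrier ?R" for p x
      using closed[OF that] by simp
  qed
  moreover have "monomial ` A \<subseteq> J"
    using assms(1) by (auto simp: J_def intro: mdvd_refl)
  ultimately have IJ: "Idl\<^bsub>?R\<^esub> (monomial ` A) \<subseteq> J"
    by (rule R.genideal_minimal)
  show ?thesis
  proof
    assume "(monomial a :: ('v, 'k) mpoly) \<in> Idl\<^bsub>?R\<^esub> (monomial ` A)"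
    with IJ have "(monomial a :: ('v, 'k) mpoly) \<in> J" by blast
    then show "\<exists>b\<in>A. mdvd b a" by (simp add: J_def)
  next
    assume "\<exists>b\<in>A. mdvd b a"
    then obtain b where b: "b \<in> A" "mdvd b a" by blast
    have ab: "a = (a - b) + b"
      using b(2) by (intro poly_mapping_eqI) (simp add: mdvd_def lookup_add lookup_minus)
    have "keys (a - b) \<subseteq> V"
      using assms(2) by (auto simp: in_keys_iff lookup_minus subset_iff)
    then have c: "(monomial (a - b) :: ('v, 'k) mpoly) \<in> carrier ?R" by simp
    have "(monomial b :: ('v, 'k) mpoly) \<in> Idl\<^bsub>?R\<^esub> (monomial ` A)"
      using R.genideal_self[OF sub] b(1) by blast
    from ideal.I_l_closed[OF R.genideal_ideal[OF sub] this c]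
    show "(monomial a :: ('v, 'k) mpoly) \<in> Idl\<^bsub>?R\<^esub> (monomial ` A)"
      by (metis ab monomial_add mpoly_ring_simps(2))
  qed
qed

lemma Idl_mono_subset_iff:
  assumes "\<forall>b\<in>A. keys b \<subseteq> V" and "\<forall>b\<in>B. keys b \<subseteq> V"
  shows "Idl\<^bsub>mpoly_ring V\<^esub> (monomial ` A :: ('v, 'k::field) mpoly set) \<subseteq> Idl\<^bsub>mpoly_ring V\<^esub> (monomial ` B)
    \<longleftrightarrow> (\<forall>a\<in>A. \<exists>b\<in>B. mdvd b a)"
proof -
  let ?R = "mpoly_ring V :: ('v, 'k) mpoly ring"
  interpret R: cring ?R by (rule cring_mpoly_ring)
  have sub: "(monomial ` A :: ('v, 'k) mpoly set) \<subseteq> carrier ?R" "(monomial ` B :: ('v, 'k) mpoly set) \<subseteq> carrier ?R"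
    using assms by auto
  have "Idl\<^bsub>?R\<^esub> (monomial ` A) \<subseteq> Idl\<^bsub>?R\<^esub> (monomial ` B) \<longleftrightarrow> monomial ` A \<subseteq> Idl\<^bsub>?R\<^esub> (monomial ` B)"
    by (rule R.Idl_subset_ideal[OF R.genideal_ideal[OF sub(2)] sub(1)])
  also have "\<dots> \<longleftrightarrow> (\<forall>a\<in>A. \<exists>b\<in>B. mdvd b a)"
    using mono_in_Idl_iff[OF assms(2), where 'k = 'k] assms(1) by auto
  finally show ?thesis .
qed

lemma ex_mdvd_minimal:
  assumes "a \<in> A"
  shows "\<exists>b\<in>A. mdvd b a \<and> (\<forall>d\<in>A. mdvd d b \<longrightarrow> d = b)"
  using assms
proof (induction "\<Sum>v\<in>keys a. lookup a v" arbitrary: a rule: less_induct)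
  case less
  show ?case
  proof (cases "\<forall>d\<in>A. mdvd d a \<longrightarrow> d = a")
    case True
    then show ?thesis using less.prems mdvd_refl by blast
  next
    case False
    then obtain d where d: "d \<in> A" "mdvd d a" "d \<noteq> a" by blast
    obtain v where "lookup d v \<noteq> lookup a v"
      using d(3) poly_mapping_eqI[of d a] by auto
    moreover have "lookup d v \<le> lookup a v"
      using d(2) by (simp add: mdvd_def)
    ultimately have v: "lookup d v < lookup a v" by simp
    have "keys d \<subseteq> keys a"
    proof
      fix w assume "w \<in> keys d"
      moreover have "lookup d w \<le> lookup a w" using d(2) by (simp add: mdvd_def)
      ultimately show "w \<in> keys a" by (simp add: in_keys_iff)
    qed
    then have "(\<Sum>v\<in>keys d. lookup d v) = (\<Sum>v\<in>keys a. lookup d v)"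
      by (intro sum.mono_neutral_left) (auto simp: in_keys_iff)
    also have "\<dots> < (\<Sum>v\<in>keys a. lookup a v)"
    proof (rule sum_strict_mono_ex1)
      show "\<forall>w\<in>keys a. lookup d w \<le> lookup a w" using d(2) by (simp add: mdvd_def)
      show "\<exists>w\<in>keys a. lookup d w < lookup a w"
        using v by (intro bexI[of _ v]) (simp_all add: in_keys_iff)
    qed simp
    finally obtain b where "b \<in> A" "mdvd b d" "\<forall>e\<in>A. mdvd e b \<longrightarrow> e = b"
      using less.hyps[of d] d(1) by blast
    with d(2) show ?thesis using mdvd_trans by blast
  qed
qed

lemma is_min_mon_gens_Idl_iff:
  assumes A: "\<forall>a\<in>A. keys a \<subseteq> V"
  shows "is_min_mon_gens V (Idl\<^bsub>mpoly_ring V\<^esub> (monomial ` A :: ('v, 'k::field) mpoly set)) G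
    \<longleftrightarrow> G = {a \<in> A. \<forall>d\<in>A. mdvd d a \<longrightarrow> d = a}"
proof -
  let ?I = "\<lambda>A. Idl\<^bsub>mpoly_ring V\<^esub> (monomial ` A :: ('v, 'k) mpoly set)"
  let ?M = "{a \<in> A. \<forall>d\<in>A. mdvd d a \<longrightarrow> d = a}"
  have eq_iff: "?I H = ?I A \<longleftrightarrow> (\<forall>a\<in>H. \<exists>b\<in>A. mdvd b a) \<and> (\<forall>a\<in>A. \<exists>b\<in>H. mdvd b a)"
    if "\<forall>a\<in>H. keys a \<subseteq> V" for H
    using Idl_mono_subset_iff[OF that A, where 'k = 'k] Idl_mono_subset_iff[OF A that, where 'k = 'k]
    by blast
  have M_sub: "?M \<subseteq> H" if H: "\<forall>a\<in>H. keys a \<subseteq> V" "?I H = ?I A" for H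
  proof
    fix a assume a: "a \<in> ?M"
    have HA: "\<forall>a\<in>H. \<exists>b\<in>A. mdvd b a" "\<forall>a\<in>A. \<exists>b\<in>H. mdvd b a"
      using eq_iff[OF H(1)] H(2) by simp_all
    obtain b where b: "b \<in> H" "mdvd b a" using HA(2) a by auto
    obtain d where d: "d \<in> A" "mdvd d b" using HA(1) b(1) by auto
    have "d = a" using a d(1) mdvd_trans[OF d(2) b(2)] by simp
    then have "b = a" using mdvd_antisym[OF b(2)] d(2) by simp
    with b show "a \<in> H" by simp
  qed
  have M_V: "\<forall>a\<in>?M. keys a \<subseteq> V" using A by blast
  have M_eq: "?I ?M = ?I A"
    unfolding eq_iff[OF M_V]
  proof (intro conjI ballI)
    fix a assume "a \<in> ?M"
    then show "\<exists>b\<in>A. mdvd b a" using mdvd_refl by (intro bexI[of _ a]) auto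
  next
    fix a assume "a \<in> A"
    then show "\<exists>b\<in>?M. mdvd b a" using ex_mdvd_minimal[of a A] by fast
  qed
  show ?thesis
  proof
    assume "is_min_mon_gens V (?I A) G"
    then have G: "\<forall>a\<in>G. keys a \<subseteq> V" "?I G = ?I A" "\<And>H. H \<subset> G \<Longrightarrow> ?I H \<noteq> ?I A"
      unfolding is_min_mon_gens_def by simp_all
    have "\<not> ?M \<subset> G" using G(3)[of ?M] M_eq by (rule contrapos_pn[rotated])
    with M_sub[OF G(1,2)] show "G = ?M" unfolding psubset_eq by (metis (no_types))
  next
    assume G: "G = ?M"
    have "?I H \<noteq> ?I A" if H: "H \<subset> ?M" for H
    proof
      assume eq: "?I H = ?I A"
      have "H \<subseteq> ?M" using H by (rule psubset_imp_subset)
      then have "\<forall>a\<in>H. keys a \<subseteq> V" using M_V by (meson subsetD)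
      from M_sub[OF this eq] have "?M \<subseteq> H" .
      with H show False by (meson leD)
    qed
    with M_V M_eq show "is_min_mon_gens V (?I A) G"
      unfolding is_min_mon_gens_def G by simp
  qed
qed

lemma min_mon_gens_Idl:
  assumes "\<forall>a\<in>A. keys a \<subseteq> V"
  shows "min_mon_gens V (Idl\<^bsub>mpoly_ring V\<^esub> (monomial ` A :: ('v, 'k::field) mpoly set))
    = {a \<in> A. \<forall>d\<in>A. mdvd d a \<longrightarrow> d = a}"
  unfolding min_mon_gens_def is_min_mon_gens_Idl_iff[OF assms] by simp

end

theory Submission
  imports Defs
begin

text \<open>
  All ideals involved are generated by squarefree monomials, so everything reduces to comparing
  families of vertex sets up to upward closure. Call \<open>{(i, a\<^sub>i)}\<close> the graph of \<open>a\<close>.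
  A set \<open>F\<close> lies in the Bier sphere iff it avoids the graph of some \<open>a \<in> M\<close> and the graph of some
  \<open>\<^bold>c\<close>-monomial \<open>b \<notin> M\<close>: moving from \<open>a\<close> to \<open>b\<close> one coordinate at a time, some step leaves \<open>M\<close>, and
  the complement of the two graphs at this step is a boundary ridge.
  Hence a nonface \<open>F\<close> is one that contains a whole row \<open>{(i, j). j \<le> c\<^sub>i}\<close>, or for which the least
  exponent vector with graph avoiding \<open>F\<close> is not in \<open>M\<close>, or for which the greatest one is in \<open>M\<close>;
  these three cases are the three polarized ideals.
\<close>

subsection \<open>Squarefree monomial ideals\<close>

lemma lookup_sum_single:
  assumes "finite F"
  shows "lookup (\<Sum>v\<in>F. Poly_Mapping.single v (f v)) w = (if w \<in> F then f w else 0)"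
  using assms by (simp add: lookup_sum lookup_single when_def)

lemma keys_sum_single_one:
  assumes "finite F"
  shows "keys (\<Sum>v\<in>F. Poly_Mapping.single v (1::nat)) = F"
  using assms by (auto simp: in_keys_iff lookup_sum_single split: if_splits)

lemma prod_var:
  assumes "finite F"
  shows "(\<Prod>v\<in>F. var v :: ('v, 'k::field) mpoly) = monomial (\<Sum>v\<in>F. Poly_Mapping.single v 1)"
  using assms
proof (induction F)
  case empty
  show ?case by (simp add: monomial_def single_one)
next
  case (insert v F)
  then show ?case by (simp add: var_def monomial_add)
qed

text \<open>Divisibility of squarefree monomials is inclusion of their supports, so the criterion
  \<open>Idl_mono_subset_iff\<close> becomes a condition on vertex sets.\<close>

lemma Idl_prod_var_subset:
  assumes "finite V" "\<A> \<subseteq> Pow V" "\<B> \<subseteq> Pow V" and "\<And>A. A \<in> \<A> \<Longrightarrow> \<exists>B\<in>\<B>. B \<subseteq> A"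
  shows "Idl\<^bsub>mpoly_ring V\<^esub> ((\<lambda>F. \<Prod>v\<in>F. var v :: ('v, 'k::field) mpoly) ` \<A>)
    \<subseteq> Idl\<^bsub>mpoly_ring V\<^esub> ((\<lambda>F. \<Prod>v\<in>F. var v) ` \<B>)"
proof -
  let ?s = "\<lambda>F. \<Sum>v\<in>F. Poly_Mapping.single v (1::nat)"
  have fin: "finite F" if "F \<in> \<A> \<union> \<B>" for F
    using that assms(1-3) by (meson Pow_iff UnE finite_subset subsetD)
  have eq: "(\<lambda>F. \<Prod>v\<in>F. var v :: ('v, 'k) mpoly) ` \<C> = monomial ` ?s ` \<C>" if "\<C> \<subseteq> \<A> \<union> \<B>" for \<C>
    unfolding image_image by (intro image_cong refl prod_var fin subsetD[OF that])
  have keys: "\<forall>b\<in>?s ` \<C>. keys b \<subseteq> V" if "\<C> \<subseteq> \<A> \<union> \<B>" for \<C>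
  proof (intro ballI)
    fix b assume "b \<in> ?s ` \<C>"
    then obtain F where F: "b = ?s F" "F \<in> \<C>" by (rule imageE)
    then have "F \<in> \<A> \<union> \<B>" using \<open>\<C> \<subseteq> \<A> \<union> \<B>\<close> by (metis subsetD)
    moreover from this have "F \<subseteq> V" using assms(2,3) by blast
    ultimately show "keys b \<subseteq> V" using F(1) fin by (simp only: keys_sum_single_one)
  qed
  have "\<forall>a\<in>?s ` \<A>. \<exists>b\<in>?s ` \<B>. mdvd b a"
  proof safe
    fix A assume A: "A \<in> \<A>"
    then obtain B where "B \<in> \<B>" "B \<subseteq> A" using assms(4) by blast
    with A show "\<exists>b\<in>?s ` \<B>. mdvd b (?s A)"
      by (intro bexI[of _ "?s B"]) (auto simp: mdvd_def lookup_sum_single fin)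
  qed
  then show ?thesis
    unfolding eq[OF Un_upper1] eq[OF Un_upper2]
    by (rule Idl_mono_subset_iff[OF keys[OF Un_upper1] keys[OF Un_upper2], THEN iffD2])
qed

text \<open>The sum of two ideals is the ideal generated by their union. That union and the union of
  the two generating sets generate the same ideal, since each lies in the ideal generated by the
  other.\<close>

lemma Idl_add_Idl:
  fixes A B :: "('v, 'k::field) mpoly set"
  assumes "A \<subseteq> carrier (mpoly_ring V)" "B \<subseteq> carrier (mpoly_ring V)"
  shows "Idl\<^bsub>mpoly_ring V\<^esub> A <+>\<^bsub>mpoly_ring V\<^esub> Idl\<^bsub>mpoly_ring V\<^esub> B = Idl\<^bsub>mpoly_ring V\<^esub> (A \<union> B)"
proof -
  let ?R = "mpoly_ring V :: ('v, 'k) mpoly ring"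
  interpret R: cring ?R by (rule cring_mpoly_ring)
  have id: "ideal (Idl\<^bsub>?R\<^esub> A) ?R" "ideal (Idl\<^bsub>?R\<^esub> B) ?R" "ideal (Idl\<^bsub>?R\<^esub> (A \<union> B)) ?R"
    using assms by (auto intro!: R.genideal_ideal)
  have sub: "A \<union> B \<subseteq> carrier ?R" using assms by blast
  have sub': "Idl\<^bsub>?R\<^esub> A \<union> Idl\<^bsub>?R\<^esub> B \<subseteq> carrier ?R"
    using id(1,2) by (auto dest: additive_subgroup.a_subset[OF ideal.axioms(1)])
  have "Idl\<^bsub>?R\<^esub> (Idl\<^bsub>?R\<^esub> A \<union> Idl\<^bsub>?R\<^esub> B) = Idl\<^bsub>?R\<^esub> (A \<union> B)"
  proof (intro equalityI R.genideal_minimal id(3) R.genideal_ideal sub')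
    have "A \<union> B \<subseteq> Idl\<^bsub>?R\<^esub> (A \<union> B)" by (rule R.genideal_self[OF sub])
    then show "Idl\<^bsub>?R\<^esub> A \<union> Idl\<^bsub>?R\<^esub> B \<subseteq> Idl\<^bsub>?R\<^esub> (A \<union> B)"
      using R.genideal_minimal[OF id(3)] by simp
    show "A \<union> B \<subseteq> Idl\<^bsub>?R\<^esub> (Idl\<^bsub>?R\<^esub> A \<union> Idl\<^bsub>?R\<^esub> B)"
      using R.genideal_self[OF assms(1)] R.genideal_self[OF assms(2)] R.genideal_self[OF sub'] by blast
  qed
  with R.union_genideal[OF id(1,2)] show ?thesis by simp
qed

subsection \<open>Faces of the Bier sphere\<close>

definition mon_graph :: "nat \<Rightarrow> nat mon \<Rightarrow> (nat \<times> nat) set" where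
  "mon_graph n a = (\<lambda>i. (i, lookup a i)) ` {1..n}"

lemma mem_mon_graph [simp]: "(i, j) \<in> mon_graph n a \<longleftrightarrow> i \<in> {1..n} \<and> j = lookup a i"
  by (auto simp: mon_graph_def)

lemma mem_Xtilde [simp]: "(i, j) \<in> Xtilde n c \<longleftrightarrow> i \<in> {1..n} \<and> j \<le> c i"
  by (auto simp: Xtilde_def)

lemma c_facet_eq: "c_facet n c a = Xtilde n c - mon_graph n a"
  by (auto simp: c_facet_def mon_graph_def)

lemma finite_Xtilde: "finite (Xtilde n c)"
proof -
  have "Xtilde n c = (SIGMA i:{1..n}. {..c i})" by auto
  then show ?thesis by simp
qed

lemma mon_graph_subset_Xtilde: "a \<in> c_monomials n c \<Longrightarrow> mon_graph n a \<subseteq> Xtilde n c"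
  by (auto simp: c_monomials_def)

lemma card_mon_graph: "card (mon_graph n a) = n"
  unfolding mon_graph_def by (subst card_image) (auto simp: inj_on_def)

lemma c_monomials_eqI:
  assumes "a \<in> c_monomials n c" "b \<in> c_monomials n c"
    and "\<And>i. i \<in> {1..n} \<Longrightarrow> lookup a i = lookup b i"
  shows "a = b"
proof (rule poly_mapping_eqI)
  fix i
  show "lookup a i = lookup b i"
  proof (cases "i \<in> {1..n}")
    case False
    then have "i \<notin> keys a" "i \<notin> keys b" using assms(1,2) by (auto simp: c_monomials_def)
    then show ?thesis by (simp add: in_keys_iff)
  qed (rule assms(3))
qed

lemma update_in_c_monomials:
  assumes "a \<in> c_monomials n c" "i \<in> {1..n}" "j \<le> c i"
  shows "Poly_Mapping.update i j a \<in> c_monomials n c"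
  using assms by (auto simp: c_monomials_def in_keys_iff lookup_update subset_iff split: if_splits)

text \<open>Induction on the number of coordinates in which \<open>a\<close> and \<open>b\<close>
  differ: overwrite one of them by the entry of \<open>b\<close>. If the result is outside
  \<open>M\<close>, this is the required step; otherwise continue from there. All entries met on the
  way come from \<open>a\<close> or \<open>b\<close>, so a set that avoids both graphs also avoids
  the graph of \<open>d\<close> and the new vertex \<open>(i, j)\<close>.\<close>

lemma leaving_step:
  assumes "a \<in> M" "M \<subseteq> c_monomials n c" "b \<in> c_monomials n c" "b \<notin> M"
  obtains d i j where "d \<in> M" "i \<in> {1..n}" "j \<le> c i" "Poly_Mapping.update i j d \<notin> M"
    "insert (i, j) (mon_graph n d) \<subseteq> mon_graph n a \<union> mon_graph n b"
proof -
  have "\<exists>d\<in>M. \<exists>i\<in>{1..n}. \<exists>j\<le>c i. Poly_Mapping.update i j d \<notin> M \<and>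
      insert (i, j) (mon_graph n d) \<subseteq> mon_graph n a \<union> mon_graph n b"
    using assms(1)
  proof (induction "card {i \<in> {1..n}. lookup a i \<noteq> lookup b i}" arbitrary: a rule: less_induct)
    case less
    have "a \<noteq> b" using less.prems assms(4) by blast
    then obtain i where i: "i \<in> {1..n}" "lookup a i \<noteq> lookup b i"
      using c_monomials_eqI[of a n c b] less.prems assms(2,3) by blast
    have bi: "lookup b i \<le> c i" using i(1) assms(3) by (auto simp: c_monomials_def)
    let ?a = "Poly_Mapping.update i (lookup b i) a"
    show ?case
    proof (cases "?a \<in> M")
      case False
      with less.prems i(1) bi show ?thesis
        by (intro bexI[of _ a] bexI[of _ i] exI[of _ "lookup b i"]) auto
    next
      case True
      have "{k \<in> {1..n}. lookup ?a k \<noteq> lookup b k} \<subset> {k \<in> {1..n}. lookup a k \<noteq> lookup b k}"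
        using i by (auto simp: lookup_update)
      then have "card {k \<in> {1..n}. lookup ?a k \<noteq> lookup b k} < card {k \<in> {1..n}. lookup a k \<noteq> lookup b k}"
        by (intro psubset_card_mono) auto
      from less.hyps[OF this True]
      have "\<exists>d\<in>M. \<exists>i\<in>{1..n}. \<exists>j\<le>c i. Poly_Mapping.update i j d \<notin> M \<and>
          insert (i, j) (mon_graph n d) \<subseteq> mon_graph n ?a \<union> mon_graph n b" .
      moreover have "mon_graph n ?a \<subseteq> mon_graph n a \<union> mon_graph n b"
        by (auto simp: lookup_update)
      ultimately show ?thesis by (meson Un_least Un_upper2 order_trans)
    qed
  qed
  then show ?thesis using that by blast
qed

section \<open>Facets and ridges of the ball\<close>

text \<open>Distinct \<open>c\<close>-monomials give incomparable sets: if \<open>a\<close> and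
  \<open>b\<close> differ at \<open>i\<close>, then \<open>(i, lookup b i)\<close> lies in
  \<open>c_facet n c a\<close> but not in \<open>c_facet n c b\<close>.\<close>

lemma facets_c_ball:
  assumes "M \<subseteq> c_monomials n c"
  shows "facets (c_ball n c M) = c_facet n c ` M"
proof -
  have sub_eq: "c_facet n c a = c_facet n c b"
    if "a \<in> M" "b \<in> M" "c_facet n c a \<subseteq> c_facet n c b" for a b
  proof -
    have "lookup a i = lookup b i" if i: "i \<in> {1..n}" for i
    proof (rule ccontr)
      assume "lookup a i \<noteq> lookup b i"
      moreover have "lookup b i \<le> c i" using i \<open>b \<in> M\<close> assms by (auto simp: c_monomials_def)
      ultimately have "(i, lookup b i) \<in> c_facet n c a" using i by (simp add: c_facet_eq)
      then have "(i, lookup b i) \<in> c_facet n c b" using \<open>c_facet n c a \<subseteq> c_facet n c b\<close> by blast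
      with i show False by (simp add: c_facet_eq)
    qed
    with that assms have "a = b" by (intro c_monomials_eqI[of a n c b]) auto
    then show ?thesis by simp
  qed
  show ?thesis
  proof (intro equalityI subsetI)
    fix F assume "F \<in> facets (c_ball n c M)"
    then have F: "F \<in> c_ball n c M" "\<And>G. G \<in> c_ball n c M \<Longrightarrow> F \<subseteq> G \<Longrightarrow> G = F"
      by (auto simp: facets_def)
    then obtain a where a: "a \<in> M" "F \<subseteq> c_facet n c a" by (auto simp: c_ball_def)
    then have "c_facet n c a = F" by (intro F(2)) (auto simp: c_ball_def)
    with a(1) show "F \<in> c_facet n c ` M" by blast
  next
    fix F assume "F \<in> c_facet n c ` M"
    then obtain a where a: "a \<in> M" "F = c_facet n c a" by blast
    have "G = F" if G: "G \<in> c_ball n c M" "F \<subseteq> G" for G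
    proof -
      obtain b where b: "b \<in> M" "G \<subseteq> c_facet n c b" using G(1) by (auto simp: c_ball_def)
      then have "c_facet n c a = c_facet n c b" using a G(2) by (intro sub_eq) auto
      then show ?thesis using a(2) b(2) G(2) by blast
    qed
    moreover have "F \<in> c_ball n c M" using a by (auto simp: c_ball_def)
    ultimately show "F \<in> facets (c_ball n c M)" by (simp add: facets_def)
  qed
qed

lemma card_c_facet:
  assumes "a \<in> c_monomials n c"
  shows "card (c_facet n c a) = card (Xtilde n c) - n"
  using mon_graph_subset_Xtilde[OF assms] finite_subset[OF mon_graph_subset_Xtilde[OF assms] finite_Xtilde]
  by (simp add: c_facet_eq card_Diff_subset card_mon_graph)

text \<open>This evaluates the number \<open>d\<close> hidden in \<open>boundary\<close>: a facet
  omits exactly one vertex from each of the \<open>n\<close> rows. Nonemptiness of \<open>M\<close>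
  provides a face that attains the maximum.\<close>

lemma Max_card_c_ball:
  assumes "M \<subseteq> c_monomials n c" "M \<noteq> {}"
  shows "Max (card ` c_ball n c M) = card (Xtilde n c) - n"
proof (rule Max_eqI)
  have "c_ball n c M \<subseteq> Pow (Xtilde n c)" by (auto simp: c_ball_def c_facet_eq)
  then show "finite (card ` c_ball n c M)"
    using finite_Xtilde by (meson finite_Pow_iff finite_imageI finite_subset)
  show "k \<le> card (Xtilde n c) - n" if k: "k \<in> card ` c_ball n c M" for k
  proof -
    obtain F a where "a \<in> M" "F \<subseteq> c_facet n c a" "k = card F" using k by (auto simp: c_ball_def)
    moreover have "finite (c_facet n c a)" by (simp add: c_facet_eq finite_Xtilde)
    ultimately show ?thesis
      using card_mono[of "c_facet n c a" F] card_c_facet[of a n c] assms(1) by auto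
  qed
  obtain a where a: "a \<in> M" using assms(2) by blast
  then have "c_facet n c a \<in> c_ball n c M" by (auto simp: c_ball_def)
  then show "card (Xtilde n c) - n \<in> card ` c_ball n c M"
    using card_c_facet[of a n c] a assms(1) by (metis imageI subsetD)
qed

text \<open>If \<open>c_facet n c b\<close> contains the ridge, then the graph of \<open>b\<close>
  lies in the graph of \<open>a\<close> together with \<open>(i, j)\<close>. As a graph has one
  vertex per row, \<open>b\<close> is \<open>a\<close> or the update of \<open>a\<close>. These two
  give different facets and both contain the ridge, so only membership of the update in
  \<open>M\<close> matters.\<close>

lemma c_facet_unique_iff:
  assumes M: "M \<subseteq> c_monomials n c" and a: "a \<in> M"
    and i: "i \<in> {1..n}" "j \<le> c i" "j \<noteq> lookup a i"
  shows "(\<exists>!H. H \<in> c_facet n c ` M \<and> c_facet n c a - {(i, j)} \<subseteq> H) \<longleftrightarrow> Poly_Mapping.update i j a \<notin> M"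
proof -
  let ?u = "Poly_Mapping.update i j a"
  have aX: "a \<in> c_monomials n c" using M a by blast
  have uX: "?u \<in> c_monomials n c" using aX i by (intro update_in_c_monomials)
  have cover: "b = a \<or> b = ?u" if b: "b \<in> M" "c_facet n c a - {(i, j)} \<subseteq> c_facet n c b" for b
  proof -
    have bX: "b \<in> c_monomials n c" using M b(1) by blast
    have *: "lookup b k = lookup a k \<or> (k = i \<and> lookup b k = j)" if k: "k \<in> {1..n}" for k
    proof -
      have "(k, lookup b k) \<notin> c_facet n c b" "lookup b k \<le> c k"
        using k bX by (auto simp: c_facet_eq c_monomials_def)
      then have "(k, lookup b k) \<notin> c_facet n c a - {(i, j)}" using b(2) by blast
      with k \<open>lookup b k \<le> c k\<close> show ?thesis by (auto simp: c_facet_eq)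
    qed
    show ?thesis
    proof (cases "lookup b i = lookup a i")
      case True
      have "b = a" by (rule c_monomials_eqI[OF bX aX]) (metis * True)
      then show ?thesis ..
    next
      case False
      have "b = ?u"
        by (rule c_monomials_eqI[OF bX uX]) (metis * False i(1) lookup_update)
      then show ?thesis ..
    qed
  qed
  have ne: "c_facet n c ?u \<noteq> c_facet n c a"
  proof -
    have "(i, j) \<in> c_facet n c a" "(i, j) \<notin> c_facet n c ?u"
      using i by (auto simp: c_facet_eq lookup_update)
    then show ?thesis by blast
  qed
  have sub: "c_facet n c a - {(i, j)} \<subseteq> c_facet n c ?u"
    by (auto simp: c_facet_eq lookup_update split: if_splits)
  show ?thesis
  proof
    assume "\<exists>!H. H \<in> c_facet n c ` M \<and> c_facet n c a - {(i, j)} \<subseteq> H"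
    then show "?u \<notin> M" using a ne sub by (metis Diff_subset imageI)
  next
    assume "?u \<notin> M"
    then show "\<exists>!H. H \<in> c_facet n c ` M \<and> c_facet n c a - {(i, j)} \<subseteq> H"
      using a cover by (intro ex1I[of _ "c_facet n c a"]) auto
  qed
qed

text \<open>A boundary ridge is the intersection of \<open>c_facet n c a\<close> and
  \<open>c_facet n c u\<close>, where \<open>a \<in> M\<close> and \<open>u \<notin> M\<close>
  differ in a single coordinate; its subsets avoid both graphs. Conversely,
  \<open>leaving_step\<close> yields such a neighbouring pair.\<close>

lemma bier_iff:
  assumes M: "M \<subseteq> c_monomials n c" and F: "F \<subseteq> Xtilde n c"
  shows "F \<in> bier n c M \<longleftrightarrow>
    (\<exists>a\<in>M. mon_graph n a \<inter> F = {}) \<and> (\<exists>b\<in>c_monomials n c - M. mon_graph n b \<inter> F = {})"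
    (is "_ \<longleftrightarrow> ?A \<and> ?B")
proof -
  have mem_bier: "F \<in> bier n c M \<longleftrightarrow> (\<exists>G\<in>c_ball n c M. card G + 1 = Max (card ` c_ball n c M) \<and>
      (\<exists>!H. H \<in> c_facet n c ` M \<and> G \<subseteq> H) \<and> F \<subseteq> G)"
    unfolding bier_def boundary_def facets_c_ball[OF M] by (rule mem_Collect_eq)
  show ?thesis
  proof
    assume "F \<in> bier n c M"
    then obtain G where G: "G \<in> c_ball n c M" "card G + 1 = Max (card ` c_ball n c M)"
      "\<exists>!H. H \<in> c_facet n c ` M \<and> G \<subseteq> H" "F \<subseteq> G"
      unfolding mem_bier by (elim bexE conjE)
    obtain a where a: "a \<in> M" "G \<subseteq> c_facet n c a" using G(1) by (auto simp: c_ball_def)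
    have aX: "a \<in> c_monomials n c" using a M by blast
    have fin: "finite (c_facet n c a)" by (simp add: c_facet_eq finite_Xtilde)
    \<comment> \<open>\<open>G\<close> is one element short of a facet, so it is that facet with a
      single vertex \<open>(i, j)\<close> deleted.\<close>
    have "card G + 1 = card (c_facet n c a)"
      using G(2) Max_card_c_ball[OF M] a(1) card_c_facet[OF aX] by auto
    then have "card (c_facet n c a - G) = 1"
      using card_Diff_subset[OF finite_subset[OF a(2) fin] a(2)] by simp
    then obtain p where p: "c_facet n c a - G = {p}" by (auto simp: card_1_singleton_iff)
    obtain i j where ij: "p = (i, j)" by (cases p)
    have Geq: "G = c_facet n c a - {(i, j)}" using p a(2) ij by blast
    have "(i, j) \<in> c_facet n c a" using p ij by blast
    then have i: "i \<in> {1..n}" "j \<le> c i" "j \<noteq> lookup a i" by (auto simp: c_facet_eq)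
    let ?u = "Poly_Mapping.update i j a"
    have "?u \<notin> M" using G(3) c_facet_unique_iff[OF M a(1) i] Geq by simp
    moreover have "?u \<in> c_monomials n c" by (rule update_in_c_monomials[OF aX i(1,2)])
    \<comment> \<open>Apart from \<open>(i, j)\<close>, which was deleted from the facet, the graph
      of \<open>?u\<close> consists of vertices of the graph of \<open>a\<close>.\<close>
    moreover have "mon_graph n ?u \<inter> F = {}"
      using G(4) Geq by (auto simp: c_facet_eq lookup_update split: if_splits)
    ultimately have ?B by blast
    moreover have "mon_graph n a \<inter> F = {}" using G(4) Geq by (auto simp: c_facet_eq)
    ultimately show "?A \<and> ?B" using a(1) by blast
  next
    assume "?A \<and> ?B"
    then obtain a b where ab: "a \<in> M" "mon_graph n a \<inter> F = {}" "b \<in> c_monomials n c" "b \<notin> M"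
      "mon_graph n b \<inter> F = {}" by blast
    obtain d i j where d: "d \<in> M" "i \<in> {1..n}" "j \<le> c i" "Poly_Mapping.update i j d \<notin> M"
      "insert (i, j) (mon_graph n d) \<subseteq> mon_graph n a \<union> mon_graph n b"
      using leaving_step[OF ab(1) M ab(3,4)] .
    have dX: "d \<in> c_monomials n c" using d(1) M by blast
    have ne: "j \<noteq> lookup d i"
    proof
      assume "j = lookup d i"
      then have "Poly_Mapping.update i j d = d" by (intro poly_mapping_eqI) (simp add: lookup_update)
      with d(1,4) show False by simp
    qed
    let ?G = "c_facet n c d - {(i, j)}"
    have fin: "finite (c_facet n c d)" by (simp add: c_facet_eq finite_Xtilde)
    have mem: "(i, j) \<in> c_facet n c d" using d(2,3) ne by (simp add: c_facet_eq)
    have "card ?G + 1 = card (c_facet n c d)" using card_Suc_Diff1[OF fin mem] by simp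
    then have "card ?G + 1 = Max (card ` c_ball n c M)"
      using Max_card_c_ball[OF M] d(1) card_c_facet[OF dX] by (metis empty_iff)
    moreover have "?G \<in> c_ball n c M" using d(1) by (auto simp: c_ball_def)
    \<comment> \<open>By \<open>leaving_step\<close>, the graph of \<open>d\<close> and the vertex
      \<open>(i, j)\<close> lie in the union of the two graphs that \<open>F\<close> avoids.\<close>
    moreover have "F \<subseteq> ?G" using F ab(2,5) d(5) unfolding c_facet_eq by blast
    moreover have "\<exists>!H. H \<in> c_facet n c ` M \<and> ?G \<subseteq> H"
      using c_facet_unique_iff[OF M d(1-3) ne] d(4) by blast
    ultimately show "F \<in> bier n c M"
      unfolding mem_bier by (intro bexI[of _ ?G] conjI)
  qed
qed

subsection \<open>Supports of polarized monomials\<close>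

definition pol_set :: "nat mon \<Rightarrow> (nat \<times> nat) set" where
  "pol_set a = (SIGMA i:keys a. {..<lookup a i})"

definition pol_star_set :: "(nat \<Rightarrow> nat) \<Rightarrow> nat mon \<Rightarrow> (nat \<times> nat) set" where
  "pol_star_set c a = (SIGMA i:keys a. {c i + 1 - lookup a i..c i})"

lemma pol_mon_eq: "pol_mon a = (\<Prod>v\<in>pol_set a. var v)"
  unfolding pol_mon_def pol_set_def by (subst prod.Sigma) (simp_all add: case_prod_unfold)

lemma pol_star_mon_eq: "pol_star_mon c a = (\<Prod>v\<in>pol_star_set c a. var v)"
  unfolding pol_star_mon_def pol_star_set_def by (subst prod.Sigma) (simp_all add: case_prod_unfold)

lemma mem_pol_set [simp]: "(i, j) \<in> pol_set a \<longleftrightarrow> j < lookup a i"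
  by (auto simp: pol_set_def in_keys_iff)

text \<open>The additive form gets rid of the truncated subtraction. Membership in
  \<open>keys a\<close> needs no mention on the right because a zero exponent makes the two
  inequalities contradictory.\<close>

lemma mem_pol_star_set [simp]: "(i, j) \<in> pol_star_set c a \<longleftrightarrow> j \<le> c i \<and> c i < j + lookup a i"
  by (auto simp: pol_star_set_def in_keys_iff)

lemma pol_set_mono: "mdvd a b \<Longrightarrow> pol_set a \<subseteq> pol_set b"
  unfolding mdvd_def by clarsimp (meson less_le_trans)

lemma pol_star_set_mono: "mdvd a b \<Longrightarrow> pol_star_set c a \<subseteq> pol_star_set c b"
  unfolding mdvd_def by clarsimp (meson add_left_mono less_le_trans)

lemma pol_set_subset_Xtilde:
  assumes "keys a \<subseteq> {1..n}" "\<And>i. i \<in> {1..n} \<Longrightarrow> lookup a i \<le> c i + 1"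
  shows "pol_set a \<subseteq> Xtilde n c"
proof
  fix p assume p: "p \<in> pol_set a"
  obtain i j where ij: "p = (i, j)" by (cases p)
  have j: "j < lookup a i" using p ij by simp
  then have "i \<in> keys a" by (simp add: in_keys_iff)
  with assms(1) have i: "i \<in> {1..n}" by (rule subsetD)
  with assms(2)[OF i] j ij show "p \<in> Xtilde n c" by simp
qed

lemma pol_star_set_subset_Xtilde: "keys a \<subseteq> {1..n} \<Longrightarrow> pol_star_set c a \<subseteq> Xtilde n c"
  by (auto simp: pol_star_set_def)

section \<open>Polarized ideals from arbitrary monomial generators\<close>

text \<open>Polarization is defined on minimal generators only. Since \<open>f\<close> is monotone
  under divisibility, the support of any \<open>a \<in> A\<close> contains that of a minimal divisor
  of \<open>a\<close> in \<open>A\<close>, so using all of \<open>A\<close> adds nothing to the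
  ideal.\<close>

lemma Idl_minimal_gens:
  assumes V: "finite V" and sub: "\<And>a. a \<in> A \<Longrightarrow> f a \<subseteq> V"
    and mono: "\<And>a b. mdvd a b \<Longrightarrow> f a \<subseteq> f b"
  shows "Idl\<^bsub>mpoly_ring V\<^esub> ((\<lambda>a. \<Prod>v\<in>f a. var v :: ('v, 'k::field) mpoly) ` {a \<in> A. \<forall>d\<in>A. mdvd d a \<longrightarrow> d = a})
    = Idl\<^bsub>mpoly_ring V\<^esub> ((\<lambda>F. \<Prod>v\<in>F. var v) ` f ` A)"
proof -
  let ?m = "{a \<in> A. \<forall>d\<in>A. mdvd d a \<longrightarrow> d = a}"
  have "Idl\<^bsub>mpoly_ring V\<^esub> ((\<lambda>F. \<Prod>v\<in>F. var v :: ('v, 'k) mpoly) ` f ` ?m)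
    = Idl\<^bsub>mpoly_ring V\<^esub> ((\<lambda>F. \<Prod>v\<in>F. var v) ` f ` A)"
  proof (intro equalityI Idl_prod_var_subset V)
    fix F assume "F \<in> f ` A"
    then obtain a where a: "a \<in> A" "F = f a" by blast
    obtain b where "b \<in> ?m" "mdvd b a" using ex_mdvd_minimal[OF a(1)] by blast
    then show "\<exists>B\<in>f ` ?m. B \<subseteq> F" using mono a(2) by blast
  qed (use sub in auto)
  then show ?thesis by (simp add: image_image)
qed

text \<open>The bound is \<open>c i + 1\<close> instead of \<open>c i\<close> so that the pure
  powers in the third summand are covered as well.\<close>

lemma pol_ideal_Idl:
  assumes "\<And>a. a \<in> A \<Longrightarrow> keys a \<subseteq> {1..n}" "\<And>a i. a \<in> A \<Longrightarrow> i \<in> {1..n} \<Longrightarrow> lookup a i \<le> c i + 1"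
  shows "pol_ideal n c (Idl\<^bsub>mpoly_ring {1..n}\<^esub> (monomial ` A :: (nat, 'k::field) mpoly set))
    = Idl\<^bsub>mpoly_ring (Xtilde n c)\<^esub> ((\<lambda>F. \<Prod>v\<in>F. var v) ` pol_set ` A)"
proof -
  have "\<forall>a\<in>A. keys a \<subseteq> {1..n}" using assms(1) by blast
  from min_mon_gens_Idl[OF this, where 'k = 'k] show ?thesis
    unfolding pol_ideal_def pol_mon_eq
    by (simp only: Idl_minimal_gens[OF finite_Xtilde pol_set_subset_Xtilde[OF assms] pol_set_mono])
qed

lemma pol_star_ideal_Idl:
  assumes "\<And>a. a \<in> A \<Longrightarrow> keys a \<subseteq> {1..n}"
  shows "pol_star_ideal n c (Idl\<^bsub>mpoly_ring {1..n}\<^esub> (monomial ` A :: (nat, 'k::field) mpoly set))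
    = Idl\<^bsub>mpoly_ring (Xtilde n c)\<^esub> ((\<lambda>F. \<Prod>v\<in>F. var v) ` pol_star_set c ` A)"
proof -
  have "\<forall>a\<in>A. keys a \<subseteq> {1..n}" using assms by blast
  from min_mon_gens_Idl[OF this, where 'k = 'k] show ?thesis
    unfolding pol_star_ideal_def pol_star_mon_eq
    by (simp only: Idl_minimal_gens[OF finite_Xtilde pol_star_set_subset_Xtilde[OF assms] pol_star_set_mono])
qed

lemma var_power: "(var i ^ k :: ('v, 'k::field) mpoly) = monomial (Poly_Mapping.single i k)"
proof (induction k)
  case 0
  show ?case by (simp add: monomial_def single_one)
next
  case (Suc k)
  have "Poly_Mapping.single i (Suc k) = Poly_Mapping.single i 1 + Poly_Mapping.single i k"
    by (simp flip: single_add)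
  then show ?case using Suc by (simp only: power_Suc monomial_add var_def[of i])
qed

subsection \<open>Nonfaces of the Bier sphere\<close>

definition c_compl :: "nat \<Rightarrow> (nat \<Rightarrow> nat) \<Rightarrow> nat mon \<Rightarrow> nat mon" where
  "c_compl n c a = (\<Sum>i=1..n. Poly_Mapping.single i (c i - lookup a i))"

lemma lookup_c_compl: "lookup (c_compl n c a) i = (if i \<in> {1..n} then c i - lookup a i else 0)"
  unfolding c_compl_def by (rule lookup_sum_single) simp

lemma c_monomialsI:
  assumes "\<And>i. i \<in> {1..n} \<Longrightarrow> lookup a i \<le> c i" "\<And>i. i \<notin> {1..n} \<Longrightarrow> lookup a i = 0"
  shows "a \<in> c_monomials n c"
proof -
  have "keys a \<subseteq> {1..n}"
  proof
    fix i assume "i \<in> keys a"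
    then show "i \<in> {1..n}" using assms(2)[of i] by (cases "i \<in> {1..n}") (auto simp: in_keys_iff)
  qed
  with assms(1) show ?thesis by (simp add: c_monomials_def)
qed

lemma c_compl_in_c_monomials: "c_compl n c a \<in> c_monomials n c"
  by (rule c_monomialsI) (auto simp: lookup_c_compl)

lemma c_compl_c_compl: "a \<in> c_monomials n c \<Longrightarrow> c_compl n c (c_compl n c a) = a"
  by (rule c_monomials_eqI[OF c_compl_in_c_monomials]) (auto simp: lookup_c_compl c_monomials_def)

text \<open>Complementation is an involution on \<open>c\<close>-monomials, so
  \<open>c_compl n c u\<close> is the only \<open>c\<close>-monomial whose complement is
  \<open>u\<close>.\<close>

lemma not_in_alexander_dual_iff:
  assumes "u \<in> c_monomials n c"
  shows "u \<notin> alexander_dual n c M \<longleftrightarrow> c_compl n c u \<in> M"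
proof -
  have dual: "u \<in> alexander_dual n c M \<longleftrightarrow> (\<exists>a. u = c_compl n c a \<and> a \<in> c_monomials n c \<and> a \<notin> M)"
    unfolding alexander_dual_def c_compl_def by (rule mem_Collect_eq)
  show ?thesis
  proof
    assume "u \<notin> alexander_dual n c M"
    then show "c_compl n c u \<in> M"
      unfolding dual using c_compl_c_compl[OF assms] c_compl_in_c_monomials[of n c u] by metis
  next
    assume "c_compl n c u \<in> M"
    then show "u \<notin> alexander_dual n c M"
      unfolding dual using c_compl_c_compl[of _ n c] by metis
  qed
qed

lemma mdvd_c_monomialsI:
  assumes "a \<in> c_monomials n c" "\<And>i. i \<in> {1..n} \<Longrightarrow> lookup a i \<le> lookup b i"
  shows "mdvd a b"
  unfolding mdvd_def
proof
  fix i show "lookup a i \<le> lookup b i"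
  proof (cases "i \<in> keys a")
    case True
    then have "i \<in> {1..n}" using assms(1) unfolding c_monomials_def by blast
    then show ?thesis by (rule assms(2))
  qed (simp add: in_keys_iff)
qed

section \<open>The three kinds of nonfaces\<close>

text \<open>Let the graph of a \<open>c\<close>-monomial \<open>a\<close> avoid \<open>F\<close>.
  Then \<open>pol_set u \<subseteq> F\<close> forces \<open>u\<close> to divide \<open>a\<close>,
  while \<open>pol_star_set c u \<subseteq> F\<close> forces \<open>a\<close> to divide
  \<open>c_compl n c u\<close>; a full row in \<open>F\<close> rules out every \<open>a\<close>. So
  each alternative violates one of the two conditions in \<open>bier_iff\<close>.\<close>

lemma nonface_iff:
  assumes mc: "multicomplex n c M" and F: "F \<subseteq> Xtilde n c"
  shows "F \<notin> bier n c M \<longleftrightarrow>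
    (\<exists>u\<in>c_monomials n c - M. pol_set u \<subseteq> F) \<or>
    (\<exists>u\<in>c_monomials n c - alexander_dual n c M. pol_star_set c u \<subseteq> F) \<or>
    (\<exists>i\<in>{1..n}. pol_set (Poly_Mapping.single i (c i + 1)) \<subseteq> F)"
    (is "_ \<longleftrightarrow> ?P \<or> ?Q \<or> ?R")
proof -
  have M: "M \<subseteq> c_monomials n c" and down: "\<And>a b. a \<in> M \<Longrightarrow> mdvd b a \<Longrightarrow> b \<in> M"
    using mc by (auto simp: multicomplex_def)
  have avoid: "(i, lookup a i) \<notin> F" if "mon_graph n a \<inter> F = {}" "i \<in> {1..n}" for a i
    using that by (metis disjoint_iff mem_mon_graph)
  show ?thesis
  proof
    assume "F \<notin> bier n c M"
    then have nb: "(\<forall>a\<in>M. mon_graph n a \<inter> F \<noteq> {}) \<or> (\<forall>b\<in>c_monomials n c - M. mon_graph n b \<inter> F \<noteq> {})"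
      using bier_iff[OF M F] by blast
    show "?P \<or> ?Q \<or> ?R"
    proof (cases ?R)
      case False
      \<comment> \<open>The free positions of row \<open>i\<close>. An empty \<open>S i\<close>
        would put the whole row, which is the support of the polarized power with exponent
        \<open>c i + 1\<close>, into \<open>F\<close>.\<close>
      define S where "S i = {j. j \<le> c i \<and> (i, j) \<notin> F}" for i
      have fin: "finite (S i)" for i by (simp add: S_def)
      have ne: "S i \<noteq> {}" if "i \<in> {1..n}" for i
      proof
        assume "S i = {}"
        then have "(i, j) \<in> F" if "j \<le> c i" for j using that by (auto simp: S_def)
        then have "pol_set (Poly_Mapping.single i (c i + 1)) \<subseteq> F"
          by (auto simp: lookup_single when_def split: if_splits)
        with False that show False by blast
      qed
      define l where "l = (\<Sum>i=1..n. Poly_Mapping.single i (Min (S i)))"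
      define g where "g = (\<Sum>i=1..n. Poly_Mapping.single i (Max (S i)))"
      have l: "lookup l i = (if i \<in> {1..n} then Min (S i) else 0)"
        and g: "lookup g i = (if i \<in> {1..n} then Max (S i) else 0)" for i
        unfolding l_def g_def by (rule lookup_sum_single, simp)+
      have lS: "lookup l i \<in> S i" and gS: "lookup g i \<in> S i" if "i \<in> {1..n}" for i
        using that Min_in[OF fin ne] Max_in[OF fin ne] by (simp_all add: l g)
      have lX: "l \<in> c_monomials n c" and gX: "g \<in> c_monomials n c"
        using lS gS by (auto intro!: c_monomialsI simp: S_def l g)
      have lF: "mon_graph n l \<inter> F = {}" and gF: "mon_graph n g \<inter> F = {}"
        using lS gS by (auto simp: S_def)
      from nb show ?thesis
      proof
        assume "\<forall>a\<in>M. mon_graph n a \<inter> F \<noteq> {}"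
        with lF lX have "l \<in> c_monomials n c - M" by blast
        \<comment> \<open>The support consists of the positions below the least free one in each
          row, all of which are in \<open>F\<close>.\<close>
        moreover have "pol_set l \<subseteq> F"
        proof clarsimp
          fix i j assume j: "j < lookup l i"
          then have i: "i \<in> {1..n}" by (auto simp: l split: if_splits)
          have "j \<notin> S i" using j i Min_le[OF fin, of j i] by (auto simp: l)
          moreover have "j \<le> c i" using lS[OF i] j by (simp add: S_def)
          ultimately show "(i, j) \<in> F" by (simp add: S_def)
        qed
        ultimately show ?thesis by blast
      next
        assume "\<forall>b\<in>c_monomials n c - M. mon_graph n b \<inter> F \<noteq> {}"
        with gF gX have "g \<in> M" by blast
        then have "c_compl n c g \<in> c_monomials n c - alexander_dual n c M"
          using not_in_alexander_dual_iff c_compl_in_c_monomials c_compl_c_compl[OF gX] by auto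
        \<comment> \<open>In row \<open>i\<close> the top \<open>c i - lookup g i\<close> positions
          are those above the greatest free one, so they are in \<open>F\<close>.\<close>
        moreover have "pol_star_set c (c_compl n c g) \<subseteq> F"
        proof clarsimp
          fix i j assume j: "j \<le> c i" "c i < j + lookup (c_compl n c g) i"
          then have i: "i \<in> {1..n}" by (auto simp: lookup_c_compl split: if_splits)
          have "j \<notin> S i" using j i Max_ge[OF fin, of j i] by (auto simp: lookup_c_compl g)
          with j(1) show "(i, j) \<in> F" by (simp add: S_def)
        qed
        ultimately show ?thesis by blast
      qed
    qed simp
  next
    assume "?P \<or> ?Q \<or> ?R"
    then consider ?P | ?Q | ?R by blast
    then show "F \<notin> bier n c M"
    proof cases
      case 1
      then obtain u where u: "u \<in> c_monomials n c" "u \<notin> M" "pol_set u \<subseteq> F" by blast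
      \<comment> \<open>Where \<open>lookup a i < lookup u i\<close>, the vertex
        \<open>(i, lookup a i)\<close> would be in \<open>pol_set u\<close> and hence in
        \<open>F\<close>. So \<open>u\<close> divides \<open>a\<close>, and \<open>a \<in> M\<close>
        would give \<open>u \<in> M\<close>.\<close>
      have "a \<notin> M" if a: "mon_graph n a \<inter> F = {}" for a
      proof -
        have "lookup u i \<le> lookup a i" if "i \<in> {1..n}" for i
          using avoid[OF a that] u(3) mem_pol_set by (meson not_le subsetD)
        then show ?thesis using mdvd_c_monomialsI[OF u(1)] down u(2) by blast
      qed
      then show ?thesis using bier_iff[OF M F] by blast
    next
      case 2
      then obtain u where u: "u \<in> c_monomials n c" "u \<notin> alexander_dual n c M" "pol_star_set c u \<subseteq> F"
        by blast
      \<comment> \<open>Dually, \<open>b\<close> divides \<open>c_compl n c u\<close>, which is in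
        \<open>M\<close> because \<open>u\<close> is outside the Alexander dual.\<close>
      have "b \<in> M" if b: "b \<in> c_monomials n c" "mon_graph n b \<inter> F = {}" for b
      proof -
        have "lookup b i \<le> lookup (c_compl n c u) i" if i: "i \<in> {1..n}" for i
        proof -
          have "(i, lookup b i) \<notin> pol_star_set c u" using avoid[OF b(2) i] u(3) by blast
          moreover have "lookup b i \<le> c i" using b(1) i by (auto simp: c_monomials_def)
          ultimately show ?thesis using i by (auto simp: lookup_c_compl)
        qed
        then show ?thesis
          using mdvd_c_monomialsI[OF b(1)] down not_in_alexander_dual_iff[OF u(1)] u(2) by blast
      qed
      then show ?thesis using bier_iff[OF M F] by blast
    next
      case 3
      then obtain i where i: "i \<in> {1..n}" "pol_set (Poly_Mapping.single i (c i + 1)) \<subseteq> F" by blast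
      have "mon_graph n a \<inter> F \<noteq> {}" if "a \<in> M" for a
      proof
        assume "mon_graph n a \<inter> F = {}"
        from avoid[OF this i(1)] i(2)
        have "(i, lookup a i) \<notin> pol_set (Poly_Mapping.single i (c i + 1))" by blast
        moreover have "lookup a i \<le> c i" using that M i(1) by (auto simp: c_monomials_def)
        ultimately show False by (simp add: lookup_single)
      qed
      then show ?thesis using bier_iff[OF M F] by blast
    qed
  qed
qed

section \<open>Comparison of the ideals\<close>

theorem theorem3p6:
  fixes n :: nat and c :: "nat \<Rightarrow> nat" and M :: "nat mon set"
  assumes "proper_multicomplex n c M"
  shows "(stanley_reisner_ideal (Xtilde n c) (bier n c M) :: (nat \<times> nat, 'k::field) mpoly set) =
           pol_ideal n c (mc_ideal n c M)
             <+>\<^bsub>mpoly_ring (Xtilde n c)\<^esub>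
           pol_star_ideal n c (mc_ideal n c (alexander_dual n c M))
             <+>\<^bsub>mpoly_ring (Xtilde n c)\<^esub>
           pol_ideal n c (Idl\<^bsub>mpoly_ring {1..n}\<^esub> ((\<lambda>i. var i ^ (c i + 1)) ` {1..n}))"
proof -
  let ?X = "Xtilde n c"
  let ?vp = "\<lambda>F. \<Prod>v\<in>F. var v :: (nat \<times> nat, 'k) mpoly"
  let ?C = "(\<lambda>i. Poly_Mapping.single i (c i + 1)) ` {1..n}"
  let ?P = "pol_set ` (c_monomials n c - M)"
  let ?Q = "pol_star_set c ` (c_monomials n c - alexander_dual n c M)"
  let ?R = "pol_set ` ?C"
  have mc: "multicomplex n c M" using assms by (simp add: proper_multicomplex_def)
  have powers: "(\<lambda>i. var i ^ (c i + 1) :: (nat, 'k) mpoly) ` {1..n} = monomial ` ?C"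
    by (simp only: var_power image_image)
  have P: "pol_ideal n c (mc_ideal n c M :: (nat, 'k) mpoly set) = Idl\<^bsub>mpoly_ring ?X\<^esub> (?vp ` ?P)"
    unfolding mc_ideal_def by (rule pol_ideal_Idl) (auto simp: c_monomials_def le_SucI)
  have Q: "pol_star_ideal n c (mc_ideal n c (alexander_dual n c M) :: (nat, 'k) mpoly set)
      = Idl\<^bsub>mpoly_ring ?X\<^esub> (?vp ` ?Q)"
    unfolding mc_ideal_def by (rule pol_star_ideal_Idl) (auto simp: c_monomials_def)
  have R: "pol_ideal n c (Idl\<^bsub>mpoly_ring {1..n}\<^esub> (monomial ` ?C) :: (nat, 'k) mpoly set)
      = Idl\<^bsub>mpoly_ring ?X\<^esub> (?vp ` ?R)"
    by (rule pol_ideal_Idl) (auto simp: lookup_single when_def)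
  have sub: "?P \<subseteq> Pow ?X" "?Q \<subseteq> Pow ?X" "?R \<subseteq> Pow ?X"
  proof -
    have "pol_set u \<subseteq> ?X" if "u \<in> c_monomials n c" for u
      using that by (intro pol_set_subset_Xtilde) (auto simp: c_monomials_def le_SucI)
    then show "?P \<subseteq> Pow ?X" by blast
    have "pol_star_set c u \<subseteq> ?X" if "u \<in> c_monomials n c" for u
      using that by (intro pol_star_set_subset_Xtilde) (auto simp: c_monomials_def)
    then show "?Q \<subseteq> Pow ?X" by blast
    have "pol_set u \<subseteq> ?X" if "u \<in> ?C" for u
      using that by (intro pol_set_subset_Xtilde) (auto simp: lookup_single when_def)
    then show "?R \<subseteq> Pow ?X" by blast
  qed
  have carr: "?vp ` \<A> \<subseteq> carrier (mpoly_ring ?X)" if "\<A> \<subseteq> Pow ?X" for \<A>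
  proof
    fix p assume "p \<in> ?vp ` \<A>"
    then obtain F where "p = ?vp F" "F \<in> \<A>" by (rule imageE)
    moreover from this have "F \<subseteq> ?X" using that by (metis PowD subsetD)
    moreover from this have "finite F" using finite_Xtilde finite_subset by blast
    ultimately show "p \<in> carrier (mpoly_ring ?X)" by (simp add: prod_var keys_sum_single_one del: One_nat_def)
  qed
  have subU: "?P \<union> ?Q \<union> ?R \<subseteq> Pow ?X" using sub by (simp only: Un_least)
  \<comment> \<open>The nonfaces are the upward closure, within \<open>?X\<close>, of the three
    families of supports.\<close>
  have nonface: "F \<notin> bier n c M \<longleftrightarrow> (\<exists>B\<in>?P \<union> ?Q \<union> ?R. B \<subseteq> F)" if "F \<subseteq> ?X" for F
    unfolding nonface_iff[OF mc that] by (simp only: bex_Un bex_simps(7) disj_assoc)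
  have "Idl\<^bsub>mpoly_ring ?X\<^esub> (?vp ` ?P) <+>\<^bsub>mpoly_ring ?X\<^esub> Idl\<^bsub>mpoly_ring ?X\<^esub> (?vp ` ?Q)
      <+>\<^bsub>mpoly_ring ?X\<^esub> Idl\<^bsub>mpoly_ring ?X\<^esub> (?vp ` ?R)
      = Idl\<^bsub>mpoly_ring ?X\<^esub> (?vp ` (?P \<union> ?Q \<union> ?R))"
    using carr[OF sub(1)] carr[OF sub(2)] carr[OF sub(3)]
    by (simp only: Idl_add_Idl image_Un Un_assoc Un_least)
  \<comment> \<open>Both families have the same upward closure: each support is itself a nonface,
    and each nonface contains a support.\<close>
  moreover have "Idl\<^bsub>mpoly_ring ?X\<^esub> (?vp ` (?P \<union> ?Q \<union> ?R))
      = Idl\<^bsub>mpoly_ring ?X\<^esub> (?vp ` {F. F \<subseteq> ?X \<and> F \<notin> bier n c M})"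
  proof (intro equalityI Idl_prod_var_subset finite_Xtilde)
    fix F assume F: "F \<in> ?P \<union> ?Q \<union> ?R"
    then have FX: "F \<subseteq> ?X" by (rule PowD[OF subsetD[OF subU]])
    have "F \<notin> bier n c M" unfolding nonface[OF FX] by (rule bexI[OF _ F]) (rule order_refl)
    with FX show "\<exists>B\<in>{F. F \<subseteq> ?X \<and> F \<notin> bier n c M}. B \<subseteq> F" by blast
  next
    fix F assume "F \<in> {F. F \<subseteq> ?X \<and> F \<notin> bier n c M}"
    then show "\<exists>B\<in>?P \<union> ?Q \<union> ?R. B \<subseteq> F" using nonface[of F] by simp
  qed (rule subU | blast)+
  ultimately show ?thesis
    unfolding stanley_reisner_ideal_def powers P Q R by simp
qed

end
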